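(* Among the meaningful products $\nabla_{i_1}\circ\nabla_{i_2}\circ\cdots\circ\nabla_{i_n}$ of $n\ge 2$ operations ($i_1,\dots,i_n\in\{1,2,3\}$), i.e. among the higher-order differential operations, the nontrivial products are those of the following three forms: $$(\operatorname{grad})\operatorname{div}\cdots\operatorname{grad}\operatorname{div}\operatorname{grad} f=(\nabla_1\circ)\nabla_3\circ\cdots\circ\nabla_1\circ\nabla_3\circ\nabla_1 f,$$ $$\operatorname{curl}\operatorname{curl}\cdots\operatorname{curl}\operatorname{curl}\operatorname{curl}\vec f=\nabla_2\circ\nabla_2\circ\cdots\circ\nabla_2\circ\nabla_2\circ\nabla_2\vec f,$$ $$(\operatorname{div})\operatorname{grad}\cdots\operatorname{div}\operatorname{grad}\operatorname{div}\vec f=(\nabla_3\circ)\nabla_1\circ\cdots\circ\nabla_3\circ\nabla_1\circ\nabla_3\vec f,$$ for arbitrary $f\in F$ and $\vec f\in\vec F$, where the terms in brackets are included when the number $n$ of terms is odd and are left out otherwise. (That is, the first form is the alternating product of $n$ operations $\nabla_1,\nabla_3$ whose rightmost factor is $\nabla_1$; the second is the $n$-fold product of $\nabla_2$; the third is the alternating product of $n$ operations $\nabla_1,\nabla_3$ whose rightmost factor is $\nabla_3$.) All other meaningful products of $n\ge 2$ operations are identically zero on their domain.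
   Context: Let $F$ be the set of all scalar functions $f:\mathbf{R}^3\to\mathbf{R}$ of the variables $(x_1,x_2,x_3)$ having continuous partial derivatives of arbitrary order, and let $\vec F$ be the set of all vector functions $\vec f=(f_1,f_2,f_3):\mathbf{R}^3\to\mathbf{R}^3$ whose coordinate functions have continuous partial derivatives of arbitrary order. Let $\vec e_1,\vec e_2,\vec e_3$ be the standard basis of $\mathbf{R}^3$. The first-order differential operations are $$\nabla_1 f=\operatorname{grad} f=\frac{\partial f}{\partial x_1}\vec e_1+\frac{\partial f}{\partial x_2}\vec e_2+\frac{\partial f}{\partial x_3}\vec e_3:\ F\to\vec F,$$ $$\nabla_2\vec f=\operatorname{curl}\vec f=\Big(\frac{\partial f_3}{\partial x_2}-\frac{\partial f_2}{\partial x_3}\Big)\vec e_1+\Big(\frac{\partial f_1}{\partial x_3}-\frac{\partial f_3}{\partial x_1}\Big)\vec e_2+\Big(\frac{\partial f_2}{\partial x_1}-\frac{\partial f_1}{\partial x_2}\Big)\vec e_3:\ \vec F\to\vec F,$$ $$\nabla_3\vec f=\operatorname{div}\vec f=\frac{\partial f_1}{\partial x_1}+\frac{\partial f_2}{\partial x_2}+\frac{\partial f_3}{\partial x_3}:\ \vec F\to F.$$ Second- and higher-order differential operations are products $\nabla_{i_1}\circ\cdots\circ\nabla_{i_n}$, $n\ge2$, in the sense of composition (the rightmost factor is applied first). Such a product is meaningful if consecutive factors are composable with respect to the domains and codomains above, i.e. for each $j<n$ the codomain ($F$ or $\vec F$) of $\nabla_{i_{j+1}}$ is the domain of $\nabla_{i_j}$;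 e.g. $\nabla_3\circ\nabla_1$ is meaningful and $\nabla_1\circ\nabla_1$ is not. The domain of a meaningful product is the domain ($F$ or $\vec F$) of its rightmost factor. A meaningful product is called trivial if it is identically equal to the zero function ($0\in F$ or $\vec 0\in\vec F$) on its domain, and nontrivial otherwise. *)

theory Defs
  imports "HOL-Analysis.Analysis"
begin

definition line_through :: "3 \<Rightarrow> (real^3 \<Rightarrow> real) \<Rightarrow> real^3 \<Rightarrow> real \<Rightarrow> real" where
  "line_through i f x = (\<lambda>t. f (x + t *\<^sub>R axis i 1))"

definition has_partial :: "3 \<Rightarrow> (real^3 \<Rightarrow> real) \<Rightarrow> bool" where
  "has_partial i f \<longleftrightarrow> (\<forall>x. line_through i f x differentiable (at 0))"

definition partial :: "3 \<Rightarrow> (real^3 \<Rightarrow> real) \<Rightarrow> (real^3 \<Rightarrow> real)" where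
  "partial i f = (\<lambda>x. deriv (line_through i f x) 0)"

text \<open>All partial derivatives of order at most \<open>k\<close>, in any order of
  differentiation, exist and are continuous on the whole space.\<close>

fun cont_partials :: "nat \<Rightarrow> (real^3 \<Rightarrow> real) \<Rightarrow> bool" where
  "cont_partials 0 f \<longleftrightarrow> continuous_on UNIV f"
| "cont_partials (Suc k) f \<longleftrightarrow>
     continuous_on UNIV f \<and> (\<forall>i. has_partial i f \<and> cont_partials k (partial i f))"

definition smooth :: "(real^3 \<Rightarrow> real) \<Rightarrow> bool" where
  "smooth f \<longleftrightarrow> (\<forall>k. cont_partials k f)"

definition smooth_vec :: "(real^3 \<Rightarrow> real^3) \<Rightarrow> bool" where
  "smooth_vec f \<longleftrightarrow> (\<forall>i. smooth (\<lambda>x. f x $ i))"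

definition grad :: "(real^3 \<Rightarrow> real) \<Rightarrow> (real^3 \<Rightarrow> real^3)" where
  "grad f = (\<lambda>x. vector [partial 1 f x, partial 2 f x, partial 3 f x])"

definition curl :: "(real^3 \<Rightarrow> real^3) \<Rightarrow> (real^3 \<Rightarrow> real^3)" where
  "curl f = (\<lambda>x. vector
     [partial 2 (\<lambda>y. f y $ 3) x - partial 3 (\<lambda>y. f y $ 2) x,
      partial 3 (\<lambda>y. f y $ 1) x - partial 1 (\<lambda>y. f y $ 3) x,
      partial 1 (\<lambda>y. f y $ 2) x - partial 2 (\<lambda>y. f y $ 1) x])"

definition divergence :: "(real^3 \<Rightarrow> real^3) \<Rightarrow> (real^3 \<Rightarrow> real)" where
  "divergence f = (\<lambda>x. partial 1 (\<lambda>y. f y $ 1) x + partial 2 (\<lambda>y. f y $ 2) x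
                     + partial 3 (\<lambda>y. f y $ 3) x)"

text \<open>The operations have different domains and codomains. Scalar and vector functions are
  therefore put into one sum type, and each operation records which of the two function
  spaces it maps from and to.\<close>

datatype fn = Scalar "real^3 \<Rightarrow> real" | Vector "real^3 \<Rightarrow> real^3"

datatype space = ScalarSpace | VectorSpace

fun members :: "space \<Rightarrow> fn set" where
  "members ScalarSpace = {Scalar f |f. smooth f}"
| "members VectorSpace = {Vector f |f. smooth_vec f}"

fun zero_of :: "space \<Rightarrow> fn" where
  "zero_of ScalarSpace = Scalar (\<lambda>x. 0)"
| "zero_of VectorSpace = Vector (\<lambda>x. 0)"

datatype diff_op = Grad | Curl | Div

fun op_dom :: "diff_op \<Rightarrow> space" where
  "op_dom Grad = ScalarSpace"
| "op_dom Curl = VectorSpace"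
| "op_dom Div = VectorSpace"

fun op_cod :: "diff_op \<Rightarrow> space" where
  "op_cod Grad = VectorSpace"
| "op_cod Curl = VectorSpace"
| "op_cod Div = ScalarSpace"

text \<open>The value \<open>undefined\<close> for arguments of the wrong kind is never reached by a
  meaningful product applied to a member of its domain.\<close>

fun nabla :: "diff_op \<Rightarrow> fn \<Rightarrow> fn" where
  "nabla Grad (Scalar f) = Vector (grad f)"
| "nabla Curl (Vector f) = Vector (curl f)"
| "nabla Div (Vector f) = Scalar (divergence f)"
| "nabla _ _ = undefined"

text \<open>The list \<open>[p\<^sub>1, \<dots>, p\<^sub>n]\<close> stands for the product
  \<open>nabla p\<^sub>1 \<circ> \<dots> \<circ> nabla p\<^sub>n\<close>: its last entry is applied first.\<close>

definition product :: "diff_op list \<Rightarrow> fn \<Rightarrow> fn" where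
  "product ps = foldr (\<circ>) (map nabla ps) id"

definition meaningful :: "diff_op list \<Rightarrow> bool" where
  "meaningful ps \<longleftrightarrow> ps \<noteq> [] \<and>
     (\<forall>j. Suc j < length ps \<longrightarrow> op_cod (ps ! Suc j) = op_dom (ps ! j))"

definition product_dom :: "diff_op list \<Rightarrow> space" where
  "product_dom ps = op_dom (last ps)"

definition product_cod :: "diff_op list \<Rightarrow> space" where
  "product_cod ps = op_cod (hd ps)"

definition trivial :: "diff_op list \<Rightarrow> bool" where
  "trivial ps \<longleftrightarrow> (\<forall>u \<in> members (product_dom ps). product ps u = zero_of (product_cod ps))"

definition grad_form :: "nat \<Rightarrow> diff_op list" where
  "grad_form n = (if odd n then [Grad] else []) @ concat (replicate (n div 2) [Div, Grad])"

definition curl_form :: "nat \<Rightarrow> diff_op list" where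
  "curl_form n = replicate n Curl"

definition div_form :: "nat \<Rightarrow> diff_op list" where
  "div_form n = (if odd n then [Div] else []) @ concat (replicate (n div 2) [Grad, Div])"

end

theory Submission
  imports Defs
begin

text \<open>Two adjacent factors of a meaningful product can be \<open>Curl, Grad\<close>, \<open>Div, Curl\<close>, \<open>Div, Grad\<close>,
  \<open>Grad, Div\<close> or \<open>Curl, Curl\<close>. The first two pairs annihilate every smooth function, because the
  mixed second derivatives of such a function agree (\<open>partial_commute\<close>). If one of these pairs
  occurs anywhere in a product, the factors to its right hand it a smooth function and the factors
  to its left map zero to zero, so the product vanishes.

  When neither pair occurs, each factor determines its left neighbour: \<open>Grad\<close> is preceded
  by \<open>Div\<close>, \<open>Div\<close> by \<open>Grad\<close> and \<open>Curl\<close> by \<open>Curl\<close>. The product is then determined by its length and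
  its rightmost factor, and the three choices of that factor give the three forms
  (\<open>meaningful_form_or_trivial\<close>).

  The three forms are not zero, since the fields \<open>exp x\<^sub>1\<close> times a constant are mapped by the
  operations to fields of the same kind (\<open>nabla_exp\<close>). On them the operations become linear maps of
  the constants. \<open>Grad\<close> and \<open>Div\<close> exchange the scalar \<open>1\<close> with the first basis vector, and \<open>Curl\<close>
  is a quarter turn of the plane spanned by the other two, so the constant never becomes zero.\<close>

section \<open>Partial derivatives of smooth functions\<close>

lemma has_partial_DERIV_0:
  assumes "has_partial i f"
  shows "(line_through i f x has_real_derivative partial i f x) (at 0)"
  using assms unfolding has_partial_def partial_def
  by (simp add: DERIV_deriv_iff_real_differentiable)

lemma has_partial_DERIV:
  assumes "has_partial i f"
  shows "((\<lambda>t. f (x + t *\<^sub>R axis i 1)) has_real_derivative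
            partial i f (x + t *\<^sub>R axis i 1)) (at t)"
proof -
  have "(\<lambda>h. f (x + (h + t) *\<^sub>R axis i 1)) = line_through i f (x + t *\<^sub>R axis i 1)"
    by (simp add: line_through_def algebra_simps)
  then show ?thesis
    using has_partial_DERIV_0[OF assms, of "x + t *\<^sub>R axis i 1"] DERIV_shift[of _ _ 0 t] by simp
qed

lemma has_partialI:
  assumes "\<And>x. (line_through i f x has_real_derivative g x) (at 0)"
  shows "has_partial i f" and "partial i f = g"
proof -
  show "has_partial i f"
    unfolding has_partial_def using assms real_differentiable_def by blast
  show "partial i f = g"
    unfolding partial_def using DERIV_imp_deriv[OF assms] by (rule ext)
qed

lemma smooth_continuous: "smooth f \<Longrightarrow> continuous_on UNIV f"
  unfolding smooth_def by (metis cont_partials.simps(1))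

lemma smooth_has_partial: "smooth f \<Longrightarrow> has_partial i f"
  unfolding smooth_def by (metis cont_partials.simps(2))

lemma smooth_partial: "smooth f \<Longrightarrow> smooth (partial i f)"
  unfolding smooth_def by (metis cont_partials.simps(2))

lemma partial_lincomb:
  assumes "has_partial i f" "has_partial i g"
  shows "has_partial i (\<lambda>x. f x + c * g x)"
    and "partial i (\<lambda>x. f x + c * g x) = (\<lambda>x. partial i f x + c * partial i g x)"
proof -
  have "(line_through i (\<lambda>x. f x + c * g x) x has_real_derivative
          partial i f x + c * partial i g x) (at 0)" for x
    using DERIV_add[OF has_partial_DERIV_0[OF assms(1)]
        DERIV_cmult[OF has_partial_DERIV_0[OF assms(2)]]]
    by (simp add: line_through_def)
  then show "has_partial i (\<lambda>x. f x + c * g x)"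
    and "partial i (\<lambda>x. f x + c * g x) = (\<lambda>x. partial i f x + c * partial i g x)"
    by (rule has_partialI)+
qed

text \<open>Sums and differences are the cases \<open>c = 1\<close> and \<open>c = -1\<close>, so one induction on the order of
  differentiation serves both.\<close>

lemma smooth_lincomb:
  assumes "smooth f" "smooth g"
  shows "smooth (\<lambda>x. f x + c * g x)"
proof -
  have "cont_partials k (\<lambda>x. f x + c * g x)" if "smooth f" "smooth g" for k f g
    using that
  proof (induction k arbitrary: f g)
    case 0
    then show ?case by (simp add: smooth_continuous continuous_intros)
  next
    case (Suc k)
    then show ?case
      by (simp add: smooth_continuous smooth_has_partial smooth_partial partial_lincomb
          continuous_intros)
  qed
  then show ?thesis using assms by (simp add: smooth_def)
qed

lemma smooth_add: "smooth f \<Longrightarrow> smooth g \<Longrightarrow> smooth (\<lambda>x. f x + g x)"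
  using smooth_lincomb[of f g 1] by simp

lemma smooth_diff: "smooth f \<Longrightarrow> smooth g \<Longrightarrow> smooth (\<lambda>x. f x - g x)"
  using smooth_lincomb[of f g "-1"] by simp

lemma partial_add:
  assumes "smooth f" "smooth g"
  shows "partial i (\<lambda>x. f x + g x) x = partial i f x + partial i g x"
  using partial_lincomb(2)[of i f g 1] assms by (simp add: smooth_has_partial)

lemma partial_diff:
  assumes "smooth f" "smooth g"
  shows "partial i (\<lambda>x. f x - g x) x = partial i f x - partial i g x"
  using partial_lincomb(2)[of i f g "-1"] assms by (simp add: smooth_has_partial)

lemma partial_zero [simp]: "partial i (\<lambda>x. 0) = (\<lambda>x. 0)"
  by (rule has_partialI(2)) (simp add: line_through_def)

section \<open>Symmetry of second partial derivatives\<close>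

text \<open>The mean value theorem, applied once along each of the two axes, turns the second
  difference of \<open>f\<close> over a square into a mixed derivative. The left side is symmetric in
  \<open>i\<close> and \<open>j\<close>, which is what makes the mixed derivatives comparable.\<close>

lemma second_difference_eq_mixed_partial:
  assumes "has_partial i f" "has_partial j (partial i f)" "0 < h"
  shows "\<exists>s t. 0 < s \<and> s < h \<and> 0 < t \<and> t < h \<and>
     f (x + h *\<^sub>R axis i 1 + h *\<^sub>R axis j 1) - f (x + h *\<^sub>R axis i 1) - f (x + h *\<^sub>R axis j 1) + f x
       = h * h * partial j (partial i f) (x + s *\<^sub>R axis i 1 + t *\<^sub>R axis j 1)"
proof -
  define \<phi> where "\<phi> s = f (x + h *\<^sub>R axis j 1 + s *\<^sub>R axis i 1) - f (x + s *\<^sub>R axis i 1)" for s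
  have "(\<phi> has_real_derivative partial i f (x + h *\<^sub>R axis j 1 + s *\<^sub>R axis i 1)
          - partial i f (x + s *\<^sub>R axis i 1)) (at s)" for s
    unfolding \<phi>_def by (intro DERIV_diff has_partial_DERIV assms)
  from MVT2[OF \<open>0 < h\<close> this] obtain s where s: "0 < s" "s < h"
    "\<phi> h - \<phi> 0 = h * (partial i f (x + h *\<^sub>R axis j 1 + s *\<^sub>R axis i 1)
          - partial i f (x + s *\<^sub>R axis i 1))"
    by auto
  from MVT2[OF \<open>0 < h\<close> has_partial_DERIV[OF assms(2), of "x + s *\<^sub>R axis i 1"]]
  obtain t where t: "0 < t" "t < h"
    "partial i f (x + s *\<^sub>R axis i 1 + h *\<^sub>R axis j 1) - partial i f (x + s *\<^sub>R axis i 1)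
       = h * partial j (partial i f) (x + s *\<^sub>R axis i 1 + t *\<^sub>R axis j 1)"
    by auto
  have "\<phi> h - \<phi> 0 = h * h * partial j (partial i f) (x + s *\<^sub>R axis i 1 + t *\<^sub>R axis j 1)"
    using s(3) t(3) by (simp add: add_ac)
  then show ?thesis
    using s t unfolding \<phi>_def by (intro exI[of _ s] exI[of _ t]) (simp add: add_ac)
qed

lemma dist_two_steps:
  assumes "0 < s" "s < h" "0 < t" "t < h"
  shows "dist (x + s *\<^sub>R axis i 1 + t *\<^sub>R axis j 1) (x :: real^3) < 2 * h"
proof -
  have "dist (x + s *\<^sub>R axis i 1 + t *\<^sub>R axis j 1) x
          = norm (s *\<^sub>R axis i (1::real) + t *\<^sub>R axis j 1 :: real^3)"
    by (simp add: dist_norm add.assoc)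
  also have "\<dots> \<le> s + t"
    using assms norm_triangle_ineq[of "s *\<^sub>R axis i (1::real) :: real^3" "t *\<^sub>R axis j 1"]
    by simp
  finally show ?thesis using assms by simp
qed

text \<open>On each square with corner \<open>x\<close> the two mixed derivatives take a common value, the scaled
  second difference, at possibly different points. As the square shrinks, both points tend
  to \<open>x\<close>, and continuity forces the mixed derivatives to agree there.\<close>

lemma partial_commute:
  assumes "smooth f"
  shows "partial i (partial j f) x = partial j (partial i f) x"
proof (rule ccontr)
  assume neq: "partial i (partial j f) x \<noteq> partial j (partial i f) x"
  define a where "a = partial i (partial j f)"
  define b where "b = partial j (partial i f)"
  (* half the gap: a and b cannot both come within e of their values at x and coincide *)
  define e where "e = dist (a x) (b x) / 2"
  have "e > 0" using neq by (simp add: e_def a_def b_def)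
  have "continuous_on UNIV a" "continuous_on UNIV b"
    unfolding a_def b_def using assms by (auto intro: smooth_continuous smooth_partial)
  then obtain d1 d2 where d: "d1 > 0" "d2 > 0"
    "\<And>y. dist y x < d1 \<Longrightarrow> dist (a y) (a x) < e" "\<And>y. dist y x < d2 \<Longrightarrow> dist (b y) (b x) < e"
    using \<open>e > 0\<close> unfolding continuous_on_iff by (metis UNIV_I)
  (* the evaluation points lie within 2 * h of x *)
  define h where "h = min d1 d2 / 2"
  have h: "h > 0" "2 * h \<le> d1" "2 * h \<le> d2" using d by (auto simp: h_def)
  note P = smooth_has_partial smooth_partial assms
  obtain s t where st: "0 < s" "s < h" "0 < t" "t < h"
    "f (x + h *\<^sub>R axis i 1 + h *\<^sub>R axis j 1) - f (x + h *\<^sub>R axis i 1) - f (x + h *\<^sub>R axis j 1) + f x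
       = h * h * b (x + s *\<^sub>R axis i 1 + t *\<^sub>R axis j 1)"
    using second_difference_eq_mixed_partial[of i f j h x] h P unfolding b_def by metis
  obtain s' t' where st': "0 < s'" "s' < h" "0 < t'" "t' < h"
    "f (x + h *\<^sub>R axis j 1 + h *\<^sub>R axis i 1) - f (x + h *\<^sub>R axis j 1) - f (x + h *\<^sub>R axis i 1) + f x
       = h * h * a (x + s' *\<^sub>R axis j 1 + t' *\<^sub>R axis i 1)"
    using second_difference_eq_mixed_partial[of j f i h x] h P unfolding a_def by metis
  define y where "y = x + s *\<^sub>R axis i 1 + t *\<^sub>R axis j 1"
  define z where "z = x + s' *\<^sub>R axis j 1 + t' *\<^sub>R axis i 1"
  have "f (x + h *\<^sub>R axis j 1 + h *\<^sub>R axis i 1) = f (x + h *\<^sub>R axis i 1 + h *\<^sub>R axis j 1)"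
    by (simp add: add_ac)
  then have "h * h * a z = h * h * b y"
    unfolding y_def z_def st(5)[symmetric] st'(5)[symmetric] by simp
  then have "a z = b y" using h(1) by simp
  moreover have "dist (b y) (b x) < e" "dist (a z) (a x) < e"
    using dist_two_steps[OF st(1-4), of x i j] dist_two_steps[OF st'(1-4), of x j i] h
    by (auto intro!: d simp: y_def z_def)
  ultimately show False
    using dist_triangle2[of "a x" "b x" "a z"] by (simp add: e_def dist_commute)
qed

section \<open>The operations on smooth functions\<close>

lemma nabla_members:
  assumes "u \<in> members (op_dom p)"
  shows "nabla p u \<in> members (op_cod p)"
  using assms
  by (cases p) (auto simp: smooth_vec_def forall_3 grad_def curl_def divergence_def
      intro!: smooth_add smooth_diff smooth_partial)

lemma vector3_zero: "(vector [0, 0, 0] :: real^3) = 0"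
  by (simp add: vec_eq_iff forall_3)

lemma nabla_zero: "nabla p (zero_of (op_dom p)) = zero_of (op_cod p)"
  by (cases p) (simp_all add: grad_def curl_def divergence_def vector3_zero)

lemma curl_grad:
  assumes "smooth f"
  shows "curl (grad f) = (\<lambda>x. 0)"
  by (rule ext)
    (simp add: curl_def grad_def vector3_zero partial_commute[OF assms, of 2 3]
      partial_commute[OF assms, of 3 1] partial_commute[OF assms, of 1 2])

lemma div_curl:
  assumes "smooth_vec f"
  shows "divergence (curl f) = (\<lambda>x. 0)"
proof
  fix x
  have s: "smooth (\<lambda>y. f y $ i)" for i using assms by (simp add: smooth_vec_def)
  show "divergence (curl f) x = 0"
    by (simp add: divergence_def curl_def partial_diff smooth_partial s
        partial_commute[OF s, of 2 1] partial_commute[OF s, of 3 1] partial_commute[OF s, of 3 2])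
qed

lemma nabla_nabla_zero:
  assumes "(p, q) \<in> {(Curl, Grad), (Div, Curl)}" "u \<in> members (op_dom q)"
  shows "nabla p (nabla q u) = zero_of (op_cod p)"
  using assms by (auto simp: curl_grad div_curl)

section \<open>Meaningful products\<close>

lemma product_Nil [simp]: "product [] = id"
  by (simp add: product_def)

lemma product_Cons [simp]: "product (p # ps) u = nabla p (product ps u)"
  by (simp add: product_def)

lemma meaningful_single [simp]: "meaningful [p]"
  by (simp add: meaningful_def)

lemma meaningful_Cons_Cons [simp]:
  "meaningful (p # q # ps) \<longleftrightarrow> op_cod q = op_dom p \<and> meaningful (q # ps)"
proof -
  have "(\<forall>j. P j) \<longleftrightarrow> P 0 \<and> (\<forall>j. P (Suc j))" for P :: "nat \<Rightarrow> bool"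
    by (metis not0_implies_Suc)
  from this[of "\<lambda>j. Suc j < length (p # q # ps) \<longrightarrow>
      op_cod ((p # q # ps) ! Suc j) = op_dom ((p # q # ps) ! j)"]
  show ?thesis by (simp add: meaningful_def)
qed

lemma product_members:
  assumes "meaningful ps" "u \<in> members (product_dom ps)"
  shows "product ps u \<in> members (product_cod ps)"
  using assms
proof (induction ps rule: induct_list012)
  case (3 p q ps)
  then show ?case
    using nabla_members[of "product (q # ps) u" p] by (simp add: product_dom_def product_cod_def)
qed (simp_all add: nabla_members meaningful_def product_dom_def product_cod_def)

text \<open>A product that is zero remains so under further operations, as they are linear.\<close>

lemma trivial_Cons:
  assumes "meaningful (p # q # ps)" "trivial (q # ps)"
  shows "trivial (p # q # ps)"
  using assms nabla_zero[of p] by (auto simp: trivial_def product_dom_def product_cod_def)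

text \<open>The pair acts on the result of the factors to its right, which is smooth; this is why the
  symmetry of second derivatives is available in the middle of a product.\<close>

lemma trivial_Cons_Cons:
  assumes "meaningful (p # q # ps)" "(p, q) \<in> {(Curl, Grad), (Div, Curl)}"
  shows "trivial (p # q # ps)"
proof -
  have "product ps u \<in> members (op_dom q)" if "u \<in> members (product_dom (p # q # ps))" for u
  proof (cases ps)
    (* the empty list is not meaningful, so product_members does not cover it *)
    case Nil
    then show ?thesis using that by (simp add: product_dom_def)
  next
    case (Cons r rs)
    then show ?thesis
      using that assms(1) product_members[of ps u] by (simp add: product_dom_def product_cod_def)
  qed
  then show ?thesis
    using nabla_nabla_zero[OF assms(2)] by (simp add: trivial_def product_cod_def)
qed

section \<open>The three forms\<close>

text \<open>The definitions of the alternating forms build them from pairs; peeling off the leftmost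
  factor instead matches the order in which the inductions below extend a product.\<close>

lemma grad_form_Suc: "grad_form (Suc n) = (if odd n then Div else Grad) # grad_form n"
  by (auto simp: grad_form_def elim!: oddE)

lemma div_form_Suc: "div_form (Suc n) = (if odd n then Grad else Div) # div_form n"
  by (auto simp: div_form_def elim!: oddE)

lemma curl_form_Suc: "curl_form (Suc n) = Curl # curl_form n"
  by (simp add: curl_form_def)

lemmas form_Suc = grad_form_Suc curl_form_Suc div_form_Suc

lemma form_0: "grad_form 0 = []" "curl_form 0 = []" "div_form 0 = []"
  by (simp_all add: grad_form_def curl_form_def div_form_def)

lemma form_length:
  "length (grad_form n) = n" "length (curl_form n) = n" "length (div_form n) = n"
  by (induction n) (simp_all add: form_0 form_Suc)

lemma form_meaningful:
  "meaningful (grad_form (Suc n))" "meaningful (curl_form (Suc n))" "meaningful (div_form (Suc n))"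
  by (induction n) (simp_all add: form_0 form_Suc)

text \<open>Induction along the product from its right end. A form can be extended on the left by exactly
  one operation to a longer form; every other composable operation creates an annihilating pair
  with the leftmost factor of the form.\<close>

lemma meaningful_form_or_trivial:
  assumes "meaningful ps"
  shows "ps \<in> {grad_form (length ps), curl_form (length ps), div_form (length ps)} \<or> trivial ps"
  using assms
proof (induction ps rule: induct_list012)
  case 1
  then show ?case by (simp add: meaningful_def)
next
  case (2 p)
  then show ?case by (cases p) (simp_all add: form_0 form_Suc)
next
  case (3 p q ps)
  consider "trivial (q # ps)" | "(p, q) \<in> {(Curl, Grad), (Div, Curl)}"
    | "q # ps \<in> {grad_form (Suc (length ps)), curl_form (Suc (length ps)), div_form (Suc (length ps))}"
      "(p, q) \<notin> {(Curl, Grad), (Div, Curl)}"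
    using 3 by auto
  then show ?case
  proof cases
    case 1
    then show ?thesis using 3 trivial_Cons by blast
  next
    case 2
    then show ?thesis using 3 trivial_Cons_Cons by blast
  next
    case 3
    then show ?thesis using \<open>meaningful (p # q # ps)\<close>
      by (cases p; cases q) (auto simp: form_Suc split: if_splits)
  qed
qed

section \<open>Exponential test functions\<close>

lemma partial_exp:
  "has_partial i (\<lambda>x. exp (x $ 1) * c)"
  "partial i (\<lambda>x. exp (x $ 1) * c) = (\<lambda>x. exp (x $ 1) * (if i = 1 then c else 0))"
proof -
  have "(line_through i (\<lambda>x. exp (x $ 1) * c) x has_real_derivative
          exp (x $ 1) * (if i = 1 then c else 0)) (at 0)" for x
    unfolding line_through_def by (auto simp: axis_def intro!: derivative_eq_intros)
  then show "has_partial i (\<lambda>x. exp (x $ 1) * c)"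
    "partial i (\<lambda>x. exp (x $ 1) * c) = (\<lambda>x. exp (x $ 1) * (if i = 1 then c else 0))"
    by (rule has_partialI)+
qed

lemma smooth_exp: "smooth (\<lambda>x. exp (x $ 1) * c)"
proof -
  have "cont_partials k (\<lambda>x. exp (x $ 1) * c)" for k
    by (induction k arbitrary: c) (auto simp: partial_exp intro!: continuous_intros)
  then show ?thesis by (simp add: smooth_def)
qed

definition exp_scalar :: "real \<Rightarrow> fn" where
  "exp_scalar c = Scalar (\<lambda>x. exp (x $ 1) * c)"

definition exp_vector :: "real^3 \<Rightarrow> fn" where
  "exp_vector v = Vector (\<lambda>x. exp (x $ 1) *\<^sub>R v)"

lemma exp_members:
  "exp_scalar c \<in> members ScalarSpace" "exp_vector v \<in> members VectorSpace"
  by (auto simp: exp_scalar_def exp_vector_def smooth_vec_def smooth_exp)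

lemma nabla_exp:
  "nabla Grad (exp_scalar c) = exp_vector (vector [c, 0, 0])"
  "nabla Curl (exp_vector v) = exp_vector (vector [0, - v $ 3, v $ 2])"
  "nabla Div (exp_vector v) = exp_scalar (v $ 1)"
  by (simp_all add: exp_scalar_def exp_vector_def grad_def curl_def divergence_def partial_exp
      fun_eq_iff vec_eq_iff forall_3)

lemma exp_neq_zero:
  "c \<noteq> 0 \<Longrightarrow> exp_scalar c \<noteq> zero_of s" "v \<noteq> 0 \<Longrightarrow> exp_vector v \<noteq> zero_of s"
  by (cases s; auto simp: exp_scalar_def exp_vector_def fun_eq_iff)+

lemma product_grad_form_exp:
  "product (grad_form n) (exp_scalar 1)
     = (if odd n then exp_vector (vector [1, 0, 0]) else exp_scalar 1)"
  by (induction n) (simp_all add: form_0 form_Suc nabla_exp)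

lemma product_div_form_exp:
  "product (div_form n) (exp_vector (vector [1, 0, 0]))
     = (if odd n then exp_scalar 1 else exp_vector (vector [1, 0, 0]))"
  by (induction n) (simp_all add: form_0 form_Suc nabla_exp)

text \<open>The constant vector runs through a cycle of length four; all that matters is that it
  stays nonzero and orthogonal to the first axis, the kernel of the quarter turn.\<close>

lemma product_curl_form_exp:
  "\<exists>v. v \<noteq> 0 \<and> v $ 1 = 0 \<and> product (curl_form n) (exp_vector (vector [0, 1, 0])) = exp_vector v"
proof (induction n)
  case 0
  show ?case
    by (rule exI[of _ "vector [0, 1, 0]"]) (simp add: form_0 vec_eq_iff forall_3)
next
  case (Suc n)
  then obtain v where v: "v \<noteq> 0" "v $ 1 = 0"
    "product (curl_form n) (exp_vector (vector [0, 1, 0])) = exp_vector v" by blast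
  then show ?case
    by (intro exI[of _ "vector [0, - v $ 3, v $ 2]"])
      (auto simp: form_Suc nabla_exp vec_eq_iff forall_3)
qed

lemma product_dom_form:
  "product_dom (grad_form (Suc n)) = ScalarSpace"
  "product_dom (curl_form (Suc n)) = VectorSpace"
  "product_dom (div_form (Suc n)) = VectorSpace"
  unfolding product_dom_def by (induction n) (simp_all add: form_0 form_Suc)

lemma form_not_trivial:
  "\<not> trivial (grad_form (Suc n))" "\<not> trivial (curl_form (Suc n))" "\<not> trivial (div_form (Suc n))"
proof -
  have e1: "vector [1, 0, 0] \<noteq> (0 :: real^3)" by (simp add: vec_eq_iff forall_3)
  have "product (grad_form (Suc n)) (exp_scalar 1) \<noteq> zero_of s" for s
    unfolding product_grad_form_exp by (simp add: exp_neq_zero e1)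
  then show "\<not> trivial (grad_form (Suc n))"
    unfolding trivial_def product_dom_form using exp_members by blast
  have "product (curl_form (Suc n)) (exp_vector (vector [0, 1, 0])) \<noteq> zero_of s" for s
    using product_curl_form_exp[of "Suc n"] exp_neq_zero(2) by metis
  then show "\<not> trivial (curl_form (Suc n))"
    unfolding trivial_def product_dom_form using exp_members by blast
  have "product (div_form (Suc n)) (exp_vector (vector [1, 0, 0])) \<noteq> zero_of s" for s
    unfolding product_div_form_exp by (simp add: exp_neq_zero e1)
  then show "\<not> trivial (div_form (Suc n))"
    unfolding trivial_def product_dom_form using exp_members by blast
qed

theorem theorem2:
  fixes n :: nat
  assumes "n \<ge> 2"
  shows "{ps. length ps = n \<and> meaningful ps \<and> \<not> trivial ps}
           = {grad_form n, curl_form n, div_form n}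
         \<and> (\<forall>ps. length ps = n \<and> meaningful ps \<and> ps \<notin> {grad_form n, curl_form n, div_form n}
                \<longrightarrow> trivial ps)"
proof -
  obtain m where n: "n = Suc m" using assms by (cases n) auto
  have "ps \<in> {grad_form n, curl_form n, div_form n}"
    if "length ps = n" "meaningful ps" "\<not> trivial ps" for ps
    using that meaningful_form_or_trivial by blast
  moreover have "length ps = n \<and> meaningful ps \<and> \<not> trivial ps"
    if "ps \<in> {grad_form n, curl_form n, div_form n}" for ps
    using that form_length[of n] form_meaningful[of m] form_not_trivial[of m] unfolding n by blast
  ultimately show ?thesis by blast
qed

end
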